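(* Consider an explicit Runge--Kutta scheme of order $p\in\mathbb{N}$ with stability function $$R(z)=\sum_{j=0}^p\frac{z^j}{j!}+\sum_{j=p+1}^s c_j\frac{z^j}{j!},\quad z\in\mathbb{C},\qquad c_{p+1}\neq1,$$ where $c_{p+1},\dots,c_s\in\mathbb{R}$ and $c_j=0$ for $j\ge s+1$. The scheme is not strongly stable if $$(-1)^{(p+1)/2}(1-c_{p+1})<0\qquad\text{in the case that } p \text{ is odd};$$ or if $$(-1)^{p/2}\big(c_{p+2}-(p+2)c_{p+1}+(p+1)\big)<0\quad\text{or}\quad 1+(-1)^{p/2}(c_{p+1}-1)\binom{p}{p/2}<0\qquad\text{in the case that } p\text{ is even}.$$
   Context: Runge--Kutta scheme: for the linear system $\frac{du}{dt}=\mathbf{L}u$, $u(0)=u^0\in\mathbb{C}^n$, $\mathbf{L}\in\mathbb{C}^{n\times n}$, and time step $\tau>0$, an explicit Runge--Kutta method with $s$ stages is $$u^k=u^{k-1}+\tau\sum_{i=1}^s b_iK_i^k,\qquad K_i^k=\mathbf{L}\Big(u^{k-1}+\tau\sum_{j=1}^{i-1}a_{ij}K_j^k\Big),\quad i=1,\dots,s.$$ It can be written as $u^k=R(\tau\mathbf{L})u^{k-1}$ with a polynomial $R$, the stability function. "Order $p$" refers to the order for linear systems, and $R$ then has the form displayed in the claim (with $s\ge p$). $\mathbf{L}\in\mathbb{C}^{n\times n}$ is Lyapunov stable if all its eigenvalues have nonpositive real part and those with zero real part are non-defective; equivalently, there is a positive definite Hermitian $\mathbf{P}$ with $\mathbf{L}^*\mathbf{P}+\mathbf{P}\mathbf{L}\le0$.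 For such $\mathbf{P}$, $\|u\|_{\mathbf{P}}=\sqrt{\langle u,\mathbf{P}u\rangle}$. Strong stability: the scheme is strongly stable if for all $n\in\mathbb{N}$, all Lyapunov stable $\mathbf{L}\in\mathbb{C}^{n\times n}$, and all positive definite Hermitian $\mathbf{P}\in\mathbb{C}^{n\times n}$ with $\mathbf{L}^*\mathbf{P}+\mathbf{P}\mathbf{L}\le0$, one has $\|u^1\|_{\mathbf{P}}\le\|u^0\|_{\mathbf{P}}$ for all $u^0\in\mathbb{C}^n$ and all sufficiently small time steps, i.e. there is $\tau_0>0$ (which may depend on $\mathbf{L}$ and $\mathbf{P}$) such that $\|R(\tau\mathbf{L})u^0\|_{\mathbf{P}}\le\|u^0\|_{\mathbf{P}}$ for all $0<\tau\le\tau_0$ and all $u^0\in\mathbb{C}^n$. $\mathbb{N}=\{1,2,\dots\}$. *)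

theory Defs
  imports
    "Jordan_Normal_Form.Schur_Decomposition"
    "Jordan_Normal_Form.Matrix_Kernel"
begin

text \<open>Vectors and matrices are those of the Jordan normal form library, where the dimension is
  an ordinary natural number. A tableau is given by its number of stages \<open>s\<close> and real
  coefficients \<open>a i j\<close>, \<open>b i\<close> with indices starting at 1; only the entries
  with \<open>1 \<le> j < i \<le> s\<close> are used.\<close>

function rk_stage ::
  "(nat \<Rightarrow> nat \<Rightarrow> real) \<Rightarrow> complex mat \<Rightarrow> real \<Rightarrow> complex vec \<Rightarrow> nat \<Rightarrow> complex vec" where
  "rk_stage a L \<tau> u i =
     L *\<^sub>v (u + vec (dim_vec u)
       (\<lambda>m. of_real \<tau> * (\<Sum>j\<in>{1..<i}. of_real (a i j) * rk_stage a L \<tau> u j $ m)))"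
  by pat_completeness auto
termination by (relation "measure (\<lambda>(a, L, \<tau>, u, i). i)") auto

declare rk_stage.simps [simp del]

definition rk_step ::
  "nat \<Rightarrow> (nat \<Rightarrow> nat \<Rightarrow> real) \<Rightarrow> (nat \<Rightarrow> real) \<Rightarrow> complex mat \<Rightarrow> real \<Rightarrow> complex vec \<Rightarrow> complex vec"
where
  "rk_step s a b L \<tau> u =
     u + vec (dim_vec u)
       (\<lambda>m. of_real \<tau> * (\<Sum>i\<in>{1..s}. of_real (b i) * rk_stage a L \<tau> u i $ m))"

definition poly_mat :: "complex poly \<Rightarrow> complex mat \<Rightarrow> complex mat" where
  "poly_mat R A = mat (dim_row A) (dim_row A)
     (\<lambda>ij. \<Sum>k\<le>degree R. coeff R k * (A ^\<^sub>m k) $$ ij)"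

text \<open>The stability function is the polynomial \<open>R\<close> with
  \<open>u\<^sup>1 = R(\<tau>L) u\<^sup>0\<close> for all linear systems and all time steps; the case
  \<open>n = 1\<close> already determines it uniquely.\<close>

definition is_stability_function ::
  "nat \<Rightarrow> (nat \<Rightarrow> nat \<Rightarrow> real) \<Rightarrow> (nat \<Rightarrow> real) \<Rightarrow> complex poly \<Rightarrow> bool" where
  "is_stability_function s a b R \<longleftrightarrow>
     (\<forall>n\<ge>1. \<forall>L\<in>carrier_mat n n. \<forall>\<tau>>0. \<forall>u\<in>carrier_vec n.
        rk_step s a b L \<tau> u = poly_mat R (of_real \<tau> \<cdot>\<^sub>m L) *\<^sub>v u)"

text \<open>An eigenvalue is non-defective if its algebraic and geometric multiplicities agree;
  \<open>char_matrix L \<mu>\<close> is \<open>L - \<mu> I\<close>.\<close>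

definition nondefective :: "complex mat \<Rightarrow> complex \<Rightarrow> bool" where
  "nondefective L \<mu> \<longleftrightarrow> Polynomial.order \<mu> (char_poly L) = kernel_dim (char_matrix L \<mu>)"

definition lyapunov_stable :: "complex mat \<Rightarrow> bool" where
  "lyapunov_stable L \<longleftrightarrow>
     (\<forall>\<mu>. eigenvalue L \<mu> \<longrightarrow> Re \<mu> \<le> 0 \<and> (Re \<mu> = 0 \<longrightarrow> nondefective L \<mu>))"

definition hermitian_mat :: "complex mat \<Rightarrow> bool" where
  "hermitian_mat A \<longleftrightarrow> mat_adjoint A = A"

text \<open>The order on \<open>complex\<close> relates only numbers with equal imaginary parts, so the
  inequalities below also say that the quadratic forms are real.\<close>

definition pos_def_hermitian :: "nat \<Rightarrow> complex mat \<Rightarrow> bool" where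
  "pos_def_hermitian n P \<longleftrightarrow> P \<in> carrier_mat n n \<and> hermitian_mat P \<and>
     (\<forall>v\<in>carrier_vec n. v \<noteq> 0\<^sub>v n \<longrightarrow> 0 < (P *\<^sub>v v) \<bullet>c v)"

definition neg_semidef_hermitian :: "nat \<Rightarrow> complex mat \<Rightarrow> bool" where
  "neg_semidef_hermitian n M \<longleftrightarrow> M \<in> carrier_mat n n \<and> hermitian_mat M \<and>
     (\<forall>v\<in>carrier_vec n. (M *\<^sub>v v) \<bullet>c v \<le> 0)"

definition norm_P :: "complex mat \<Rightarrow> complex vec \<Rightarrow> real" where
  "norm_P P u = sqrt (Re (u \<bullet>c (P *\<^sub>v u)))"

definition strongly_stable ::
  "nat \<Rightarrow> (nat \<Rightarrow> nat \<Rightarrow> real) \<Rightarrow> (nat \<Rightarrow> real) \<Rightarrow> bool" where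
  "strongly_stable s a b \<longleftrightarrow>
     (\<forall>n\<ge>1. \<forall>L P. L \<in> carrier_mat n n \<and> lyapunov_stable L \<and> pos_def_hermitian n P \<and>
        neg_semidef_hermitian n (mat_adjoint L * P + P * L) \<longrightarrow>
        (\<exists>\<tau>\<^sub>0>0. \<forall>\<tau>. 0 < \<tau> \<and> \<tau> \<le> \<tau>\<^sub>0 \<longrightarrow>
           (\<forall>u\<in>carrier_vec n. norm_P P (rk_step s a b L \<tau> u) \<le> norm_P P u)))"

end

(* For P = 1 and dissipation D = - (L + adjoint of L), expand |R(tau L) u|^2 in powers of tau with the Gram
   numbers Re <L^j u, L^k u>. Up to order p the expansion agrees with that of |exp(tau L) u|^2,
   whose decay is the integral of <exp(t L) u, D exp(t L) u> over [0, tau]; the first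
   deviation is governed by c (p + 1), c (p + 2).

   If L is the scalar i, there is no dissipation and the leading deviation must not be positive:
   this gives the conditions at the orders p + 1 (p odd) and p + 2 (p even).

   For p = 2 m and the last condition, take D = e0 e0^T of rank one, and choose u depending on tau
   such that the first coordinate of exp(t L) u is approximately tau^m q(t / tau) on [0, tau].
   The decay is then tau^(2 m + 1) times the integral of q^2 over [0, 1], whereas the deviation depends
   only on the leading coefficient of q. The Legendre polynomial minimises the decay for a given
   leading coefficient, which is where the central binomial coefficient comes from. *)
theory Submission
  imports Defs "Jordan_Normal_Form.Jordan_Normal_Form_Uniqueness"
begin

section \<open>Legendre polynomials on the unit interval\<close>

text \<open>The integral of \<open>f\<close> over [0, 1], taken term by term, so that integration
  becomes a statement about finite sums of coefficients.\<close>

definition unit_integral :: "real poly \<Rightarrow> real" where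
  "unit_integral f = (\<Sum>j\<le>degree f. coeff f j / real (Suc j))"

lemma unit_integral_altdef:
  assumes "degree f \<le> d"
  shows "unit_integral f = (\<Sum>j\<le>d. coeff f j / real (Suc j))"
  unfolding unit_integral_def using assms
  by (intro sum.mono_neutral_left) (auto simp: coeff_eq_0)

lemma unit_integral_add: "unit_integral (f + g) = unit_integral f + unit_integral g"
proof -
  let ?d = "max (degree f) (degree g)"
  show ?thesis
    using unit_integral_altdef[of f ?d] unit_integral_altdef[of g ?d]
      unit_integral_altdef[of "f + g" ?d] degree_add_le_max[of f g]
    by (simp add: sum.distrib add_divide_distrib)
qed

lemma unit_integral_smult: "unit_integral (smult a f) = a * unit_integral f"
  using unit_integral_altdef[of "smult a f" "degree f"] degree_smult_le[of a f]
  by (simp add: unit_integral_def sum_distrib_left)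

text \<open>Fundamental theorem of calculus: the factor \<open>Suc j\<close> produced by
  differentiation cancels the denominator, and the sum of all coefficients except the constant one
  remains.\<close>

lemma unit_integral_pderiv: "unit_integral (pderiv f) = poly f 1 - poly f 0"
proof -
  have "unit_integral (pderiv f) = (\<Sum>j\<le>degree f. coeff (pderiv f) j / real (Suc j))"
    by (rule unit_integral_altdef) (simp add: degree_pderiv)
  also have "\<dots> = (\<Sum>j\<le>degree f. coeff f (Suc j))"
    by (simp add: coeff_pderiv del: of_nat_Suc)
  also have "coeff f 0 + \<dots> = (\<Sum>j\<le>Suc (degree f). coeff f j)"
    by (subst sum.atMost_Suc_shift) simp
  also have "\<dots> = poly f 1"
    by (simp add: poly_altdef coeff_eq_0)
  finally show ?thesis by (simp add: poly_0_coeff_0)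
qed

lemma unit_integral_by_parts:
  assumes "poly (f * g) 0 = 0" "poly (f * g) 1 = 0"
  shows "unit_integral (pderiv f * g) = - unit_integral (f * pderiv g)"
  using unit_integral_pderiv[of "f * g"] assms
  by (simp add: pderiv_mult unit_integral_add mult.commute del: poly_mult)

lemma power_dvd_pderiv:
  fixes f :: "real poly"
  assumes "q ^ Suc k dvd f"
  shows "q ^ k dvd pderiv f"
proof -
  from assms obtain h where h: "f = q ^ Suc k * h" by (elim dvdE)
  have "pderiv f = q ^ Suc k * pderiv h + h * pderiv (q ^ Suc k)"
    unfolding h by (rule pderiv_mult)
  also have "\<dots> = q ^ k * (q * pderiv h + smult (of_nat (Suc k)) (h * pderiv q))"
    unfolding pderiv_power_Suc by (simp add: algebra_simps)
  finally show ?thesis by simp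
qed

text \<open>Each derivative costs at most one power of \<open>q\<close>. For
  \<open>q = node_poly\<close> this makes the boundary terms vanish in repeated integration by
  parts.\<close>

lemma power_dvd_higher_pderiv:
  fixes q :: "real poly"
  shows "i \<le> m \<Longrightarrow> q ^ (m - i) dvd (pderiv ^^ i) (q ^ m)"
proof (induction i)
  case (Suc i)
  then have "q ^ Suc (m - Suc i) dvd (pderiv ^^ i) (q ^ m)" by (simp add: Suc_diff_Suc del: power_Suc)
  then show ?case by (simp add: power_dvd_pderiv)
qed simp

text \<open>The polynomial x (x - 1), which vanishes at both ends of the interval.\<close>

definition node_poly :: "real poly" where "node_poly = [:0, 1:] * [:-1, 1:]"

text \<open>Integration by parts, \<open>i\<close> times. Before each step fewer than
  \<open>m\<close> derivatives have been taken, so a factor \<open>node_poly\<close> survives and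
  there are no boundary terms.\<close>

lemma unit_integral_higher_pderiv_mult:
  "i \<le> m \<Longrightarrow> unit_integral ((pderiv ^^ i) (node_poly ^ m) * h)
     = (-1) ^ i * unit_integral (node_poly ^ m * (pderiv ^^ i) h)"
proof (induction i arbitrary: h)
  case (Suc i)
  have node: "poly node_poly 0 = 0" "poly node_poly 1 = 0" by (simp_all add: node_poly_def)
  have "node_poly dvd node_poly ^ (m - i)" using Suc.prems by (intro dvd_power) auto
  also have "\<dots> dvd (pderiv ^^ i) (node_poly ^ m)" using Suc.prems by (intro power_dvd_higher_pderiv) simp
  finally obtain k where k: "(pderiv ^^ i) (node_poly ^ m) = node_poly * k" by (elim dvdE)
  have "unit_integral ((pderiv ^^ Suc i) (node_poly ^ m) * h)
      = - unit_integral ((pderiv ^^ i) (node_poly ^ m) * pderiv h)"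
    unfolding funpow.simps comp_def
    by (rule unit_integral_by_parts) (simp_all add: k node)
  also have "\<dots> = (-1) ^ Suc i * unit_integral (node_poly ^ m * (pderiv ^^ Suc i) h)"
    using Suc.IH[of "pderiv h"] Suc.prems by (simp add: funpow_swap1)
  finally show ?case .
qed simp

text \<open>The Beta integral, with a sign because the second factor is x - 1 instead of 1 - x.
  Integration by parts trades a power of x - 1 for a power of x.\<close>

lemma unit_integral_beta:
  "unit_integral ([:0, 1:] ^ a * [:-1, 1:] ^ b) = (-1) ^ b * fact a * fact b / fact (Suc (a + b))"
proof (induction b arbitrary: a)
  case 0
  have a: "[:0, 1:] ^ a = (monom 1 a :: real poly)" by (metis monom_altdef smult_1_left)
  have "unit_integral ([:0, 1:] ^ a) = (\<Sum>j\<le>a. (if a = j then 1 else 0) / real (Suc j))"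
    unfolding a unit_integral_def by (simp add: degree_monom_eq)
  also have "\<dots> = (\<Sum>j\<in>{a}. 1 / real (Suc j))"
    by (intro sum.mono_neutral_cong_right) auto
  finally show ?case by simp
next
  case (Suc b)
  have "pderiv ([:0, 1:] ^ Suc a :: real poly) = smult (real (Suc a)) ([:0, 1:] ^ a)"
    unfolding pderiv_power_Suc by (simp add: pderiv_pCons)
  moreover have "pderiv ([:-1, 1:] ^ Suc b :: real poly) = smult (real (Suc b)) ([:-1, 1:] ^ b)"
    unfolding pderiv_power_Suc by (simp add: pderiv_pCons)
  moreover have "unit_integral (pderiv ([:0, 1:] ^ Suc a) * [:-1, 1:] ^ Suc b)
      = - unit_integral ([:0, 1:] ^ Suc a * pderiv ([:-1, 1:] ^ Suc b))"
    by (rule unit_integral_by_parts) simp_all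
  ultimately have "real (Suc a) * unit_integral ([:0, 1:] ^ a * [:-1, 1:] ^ Suc b)
      = - (real (Suc b) * unit_integral ([:0, 1:] ^ Suc a * [:-1, 1:] ^ b))"
    by (simp only: mult_smult_left mult_smult_right unit_integral_smult)
  also have "\<dots> = - real (Suc b) * ((-1) ^ b * fact (Suc a) * fact b / fact (Suc (Suc a + b)))"
    unfolding Suc.IH[of "Suc a"] by (simp only: mult_minus_left)
  also have "\<dots> = real (Suc a) * ((-1) ^ Suc b * fact a * fact (Suc b) / fact (Suc (a + Suc b)))"
    by (simp only: fact_Suc[of a] fact_Suc[of b] power_Suc add_Suc add_Suc_right)
      (simp add: mult_ac del: of_nat_Suc fact_Suc)
  finally show ?case by (simp only: mult_cancel_left) simp
qed

text \<open>Rodrigues' formula on \<open>[0, 1]\<close>, without the factor \<open>1/m!\<close>.\<close>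

definition legendre_poly :: "nat \<Rightarrow> real poly" where
  "legendre_poly m = (pderiv ^^ m) (node_poly ^ m)"

lemma degree_node_poly_power: "degree (node_poly ^ m) = 2 * m"
  by (simp add: node_poly_def degree_power_eq degree_mult_eq)

lemma lead_coeff_node_poly_power: "coeff (node_poly ^ m) (2 * m) = 1"
proof -
  have "coeff (node_poly ^ m) (degree (node_poly ^ m)) = 1"
    by (simp add: node_poly_def lead_coeff_mult lead_coeff_power)
  then show ?thesis by (simp only: degree_node_poly_power)
qed

lemma degree_legendre_poly: "degree (legendre_poly m) = m"
  unfolding legendre_poly_def degree_higher_pderiv degree_node_poly_power by simp

lemma coeff_legendre_poly: "coeff (legendre_poly m) m = fact (2 * m) / fact m"
proof -
  have "coeff (legendre_poly m) m = pochhammer (real (Suc m)) m"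
    unfolding legendre_poly_def coeff_higher_pderiv
    using lead_coeff_node_poly_power[of m] by (simp add: mult_2)
  also have "\<dots> = fact (2 * m) / fact m"
    using pochhammer_product'[of "1::real" m m]
    by (simp add: mult_2 add.commute nonzero_eq_divide_eq flip: pochhammer_fact)
  finally show ?thesis .
qed

text \<open>Moving \<open>m\<close> derivatives from one factor to the other leaves the derivative
  of order 2 m of a monic polynomial of degree 2 m, which is the constant (2 m)!. The rest is a Beta
  integral.\<close>

lemma unit_integral_legendre_square:
  "unit_integral (legendre_poly m ^ 2) = (fact m)\<^sup>2 / real (2 * m + 1)"
proof -
  have "(pderiv ^^ m) (legendre_poly m) = (pderiv ^^ (2 * m)) (node_poly ^ m)"
    by (simp add: legendre_poly_def funpow_add mult_2)
  also have "\<dots> = [:fact (2 * m):]"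
  proof (rule poly_eqI)
    fix j
    show "coeff ((pderiv ^^ (2 * m)) (node_poly ^ m)) j = coeff [:fact (2 * m):] j"
      using lead_coeff_node_poly_power[of m] degree_node_poly_power[of m]
      by (cases j) (simp_all add: coeff_higher_pderiv coeff_eq_0 pochhammer_fact)
  qed
  finally have "unit_integral (legendre_poly m ^ 2)
      = (-1) ^ m * unit_integral (node_poly ^ m * [:fact (2 * m):])"
    using unit_integral_higher_pderiv_mult[of m m "legendre_poly m"]
    by (simp add: legendre_poly_def power2_eq_square)
  also have "\<dots> = (-1) ^ m * (fact (2 * m) * ((-1) ^ m * fact m * fact m / fact (Suc (m + m))))"
  proof -
    have "node_poly ^ m * [:fact (2 * m):] = smult (fact (2 * m)) ([:0, 1:] ^ m * [:-1, 1:] ^ m)"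
      unfolding node_poly_def power_mult_distrib by simp
    then show ?thesis by (simp only: unit_integral_smult unit_integral_beta)
  qed
  also have "\<dots> = (fact m)\<^sup>2 / real (2 * m + 1)"
  proof -
    have "fact (Suc (m + m)) = real (2 * m + 1) * fact (2 * m)"
      unfolding mult_2 by (simp only: fact_Suc Suc_eq_plus1[symmetric])
    then have "(-1) ^ m * (fact (2 * m) * ((-1) ^ m * fact m * fact m / fact (Suc (m + m))))
        = ((-1) ^ m * (-1) ^ m) * (fact m)\<^sup>2 / real (2 * m + 1)"
      by (simp add: power2_eq_square del: fact_Suc)
    also have "(-1) ^ m * (-1) ^ m = (1 :: real)" by (simp flip: power_mult_distrib)
    finally show ?thesis by simp
  qed
  finally show ?thesis .
qed

text \<open>Sorted by total degree, to match the limits that \<open>legendre_energy_growth\<close>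
  obtains order by order.\<close>

lemma unit_integral_square:
  assumes "degree q = m"
  shows "unit_integral (q ^ 2) = (\<Sum>N\<le>2*m. (\<Sum>i\<le>N. coeff q i * coeff q (N - i)) / real (Suc N))"
  using assms degree_mult_le[of q q]
  by (subst unit_integral_altdef[of _ "2 * m"]) (simp_all add: power2_eq_square coeff_mult)

section \<open>Energy expansion\<close>

text \<open>The square of side \<open>s\<close> lies in the triangle below the diagonal 2 s, and
  \<open>t\<close> vanishes on the rest of that triangle.\<close>

lemma sum_square_eq_sum_diagonals:
  fixes t :: "nat \<Rightarrow> nat \<Rightarrow> real"
  assumes "\<And>j k. s < j \<or> s < k \<Longrightarrow> t j k = 0"
  shows "(\<Sum>j\<le>s. \<Sum>k\<le>s. t j k) = (\<Sum>N\<le>2*s. \<Sum>i\<le>N. t i (N - i))"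
proof -
  have "(\<Sum>N\<le>2*s. \<Sum>i\<le>N. t i (N - i)) = (\<Sum>(i,j)\<in>{(i,j). i + j \<le> 2*s}. t i j)"
    by (rule sum.triangle_reindex_eq[symmetric])
  also have "\<dots> = (\<Sum>(i,j)\<in>{..s} \<times> {..s}. t i j)"
  proof (rule sum.mono_neutral_right)
    have "{(i,j). i + j \<le> 2*s} \<subseteq> {..2*s} \<times> {..2*s}" by auto
    then show "finite {(i,j). i + j \<le> 2*s}" by (rule finite_subset) auto
  qed (auto, (metis assms not_le)+)
  finally show ?thesis by (simp add: sum.cartesian_product)
qed

text \<open>Taylor coefficients of the energy balance of exp(t L) u, with \<open>G\<close> the Gram
  numbers and \<open>g j\<close> the first coordinate of L^j u. Multiply by Suc N = i + (Suc N - i):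
  each summand lowers one of the factorials, and the two resulting sums of order \<open>N\<close>
  combine by the hypothesis.\<close>

lemma leibniz_energy:
  fixes G :: "nat \<Rightarrow> nat \<Rightarrow> real"
  assumes "\<And>j k. G (Suc j) k + G j (Suc k) = - g j * g k"
  shows "(\<Sum>i\<le>Suc N. G i (Suc N - i) / (fact i * fact (Suc N - i)))
       = - (\<Sum>i\<le>N. g i * g (N - i) / (fact i * fact (N - i))) / real (Suc N)"
proof -
  let ?q = "\<lambda>i. G i (Suc N - i) / (fact i * fact (Suc N - i))"
  have "(\<Sum>i\<le>Suc N. real i * ?q i) = (\<Sum>i\<le>N. G (Suc i) (N - i) / (fact i * fact (N - i)))"
    by (subst sum.atMost_Suc_shift) (simp add: divide_simps)
  moreover have "(\<Sum>i\<le>Suc N. real (Suc N - i) * ?q i) = (\<Sum>i\<le>N. G i (Suc N - i) / (fact i * fact (N - i)))"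
    by (subst sum.atMost_Suc) (auto intro!: sum.cong simp: Suc_diff_le divide_simps)
  moreover have "real (Suc N) * (\<Sum>i\<le>Suc N. ?q i)
      = (\<Sum>i\<le>Suc N. real i * ?q i) + (\<Sum>i\<le>Suc N. real (Suc N - i) * ?q i)"
    unfolding sum_distrib_left sum.distrib[symmetric]
    by (intro sum.cong refl) (metis atMost_iff distrib_right le_add_diff_inverse of_nat_add)
  moreover have "(\<Sum>i\<le>N. G (Suc i) (N - i) / (fact i * fact (N - i)))
      + (\<Sum>i\<le>N. G i (Suc N - i) / (fact i * fact (N - i)))
      = - (\<Sum>i\<le>N. g i * g (N - i) / (fact i * fact (N - i)))"
    unfolding sum_negf[symmetric] sum.distrib[symmetric]
    by (intro sum.cong refl) (simp add: assms Suc_diff_le flip: add_divide_distrib)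
  ultimately show ?thesis by (simp add: field_simps)
qed

definition rk_coeff :: "nat \<Rightarrow> (nat \<Rightarrow> real) \<Rightarrow> nat \<Rightarrow> real" where
  "rk_coeff p c j = (if j \<le> p then 1 else c j) / fact j"

text \<open>For \<open>G j k = Re \<langle>L\<^sup>j u, L\<^sup>k u\<rangle>\<close> this is the coefficient of \<open>\<tau>\<^sup>N\<close> in
  \<open>\<parallel>R(\<tau>L)u\<parallel>\<^sup>2\<close>.\<close>

definition energy_coeff :: "nat \<Rightarrow> (nat \<Rightarrow> real) \<Rightarrow> (nat \<Rightarrow> nat \<Rightarrow> real) \<Rightarrow> nat \<Rightarrow> real" where
  "energy_coeff p c G N = (\<Sum>i\<le>N. rk_coeff p c i * rk_coeff p c (N - i) * G i (N - i))"

text \<open>All weights up to order \<open>p\<close> are those of the exponential series, so this is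
  \<open>leibniz_energy\<close>.\<close>

lemma energy_coeff_le_order:
  fixes G :: "nat \<Rightarrow> nat \<Rightarrow> real"
  assumes "\<And>j k. G (Suc j) k + G j (Suc k) = - g j * g k" and "Suc N \<le> p"
  shows "energy_coeff p c G (Suc N)
    = - (\<Sum>i\<le>N. g i * g (N - i) / (fact i * fact (N - i))) / real (Suc N)"
  unfolding leibniz_energy[of G, OF assms(1), symmetric] energy_coeff_def
  using assms(2) by (intro sum.cong refl) (auto simp: rk_coeff_def)

text \<open>Only the index pairs (0, p + 1) and (p + 1, 0) involve \<open>c (Suc p)\<close>; by
  symmetry they deviate from the exponential series equally.\<close>

lemma energy_coeff_Suc_order:
  fixes G :: "nat \<Rightarrow> nat \<Rightarrow> real"
  assumes "\<And>j k. G (Suc j) k + G j (Suc k) = - g j * g k" and "\<And>j k. G j k = G k j"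
  shows "energy_coeff p c G (Suc p)
    = - (\<Sum>i\<le>p. g i * g (p - i) / (fact i * fact (p - i))) / real (Suc p)
      + 2 * (c (Suc p) - 1) * G 0 (Suc p) / fact (Suc p)"
proof -
  let ?d = "\<lambda>i. rk_coeff p c i * rk_coeff p c (Suc p - i) * G i (Suc p - i)
     - G i (Suc p - i) / (fact i * fact (Suc p - i))"
  have "(\<Sum>i\<le>Suc p. ?d i) = (\<Sum>i\<in>{0, Suc p}. ?d i)"
    by (rule sum.mono_neutral_right) (auto simp: rk_coeff_def)
  also have "\<dots> = 2 * (c (Suc p) - 1) * G 0 (Suc p) / fact (Suc p)"
    using assms(2)[of "Suc p" 0] by (simp add: rk_coeff_def field_simps del: fact_Suc)
  finally show ?thesis
    unfolding leibniz_energy[of G, OF assms(1), symmetric] energy_coeff_def by (simp only: sum_subtractf)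
qed

text \<open>Without dissipation the exponential part vanishes. The deviating first indices are 0, 1,
  p + 1 and p + 2, distinct because p \<ge> 1, and skewness turns \<open>G 1 (Suc p)\<close> into
  \<open>- G 0 (p + 2)\<close>.\<close>

lemma energy_coeff_Suc_Suc_order:
  fixes G :: "nat \<Rightarrow> nat \<Rightarrow> real"
  assumes "\<And>j k. G (Suc j) k + G j (Suc k) = 0" and "\<And>j k. G j k = G k j" and "p \<ge> 1"
  shows "energy_coeff p c G (Suc (Suc p))
    = 2 * (c (p + 2) - (real p + 2) * c (p + 1) + (real p + 1)) * G 0 (p + 2) / fact (p + 2)"
proof -
  let ?N = "Suc (Suc p)"
  let ?d = "\<lambda>i. rk_coeff p c i * rk_coeff p c (?N - i) * G i (?N - i)
     - G i (?N - i) / (fact i * fact (?N - i))"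
  have "(\<Sum>i\<le>?N. ?d i) = (\<Sum>i\<in>{0, 1, Suc p, ?N}. ?d i)"
    using assms(3) by (intro sum.mono_neutral_right) (auto simp: rk_coeff_def)
  also have "\<dots> = 2 * (c ?N - 1) * G 0 ?N / fact ?N + 2 * (c (Suc p) - 1) * G 1 (Suc p) / fact (Suc p)"
    using assms(2)[of ?N 0] assms(2)[of "Suc p" 1] assms(3)
    by (simp add: rk_coeff_def field_simps del: fact_Suc)
  also have "G 1 (Suc p) = - G 0 ?N" using assms(1)[of 0 "Suc p"] by simp
  also have "2 * (c ?N - 1) * G 0 ?N / fact ?N + 2 * (c (Suc p) - 1) * - G 0 ?N / fact (Suc p)
     = 2 * (c (p + 2) - (real p + 2) * c (p + 1) + (real p + 1)) * G 0 (p + 2) / fact (p + 2)"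
  proof -
    have f: "fact (Suc p) = (fact (p + 2) / (real p + 2) :: real)" by (simp add: field_simps)
    show ?thesis unfolding f by (simp add: field_simps del: fact_Suc)
  qed
  finally have "(\<Sum>i\<le>?N. ?d i) = 2 * (c (p + 2) - (real p + 2) * c (p + 1) + (real p + 1)) * G 0 (p + 2) / fact (p + 2)" .
  moreover have "(\<Sum>i\<le>?N. G i (?N - i) / (fact i * fact (?N - i))) = 0"
    using leibniz_energy[of G "\<lambda>_. 0" "Suc p"] assms(1) by simp
  ultimately show ?thesis unfolding energy_coeff_def by (simp only: sum_subtractf)
qed

section \<open>Energy growth for small time steps\<close>

text \<open>Divide the increment by t^K and pass to the limit. Since \<open>S\<close> may vary with
  \<open>t\<close>, orders below \<open>K\<close> can contribute as well; orders above
  \<open>K\<close> keep a spare power of \<open>t\<close> and disappear.\<close>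

lemma eventually_energy_gt:
  fixes S :: "real \<Rightarrow> nat \<Rightarrow> real"
  assumes "0 < K" "K \<le> M"
    and low: "\<And>N. 0 < N \<Longrightarrow> N \<le> K \<Longrightarrow> ((\<lambda>t. t ^ N * S t N / t ^ K) \<longlongrightarrow> l N) (at_right 0)"
    and high: "\<And>N. K < N \<Longrightarrow> ((\<lambda>t. S t N) \<longlongrightarrow> h N) (at_right 0)"
    and pos: "0 < (\<Sum>N=1..K. l N)"
  shows "eventually (\<lambda>t. S t 0 < (\<Sum>N\<le>M. t ^ N * S t N)) (at_right 0)"
proof -
  have "((\<lambda>t. t ^ N * S t N / t ^ K) \<longlongrightarrow> 0) (at_right 0)" if "K < N" for N
  proof -
    have "((\<lambda>t. t ^ (N - K) * S t N) \<longlongrightarrow> 0 ^ (N - K) * h N) (at_right 0)"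
      using high[OF that] by (intro tendsto_intros)
    then have "((\<lambda>t. t ^ (N - K) * S t N) \<longlongrightarrow> 0) (at_right 0)"
      using that by (simp add: power_0_left)
    moreover have "eventually (\<lambda>t. t ^ (N - K) * S t N = t ^ N * S t N / t ^ K) (at_right 0)"
      unfolding eventually_at_right_field using that
      by (intro exI[of _ 1]) (auto simp: power_diff)
    ultimately show ?thesis by (rule Lim_transform_eventually)
  qed
  then have lim: "((\<lambda>t. \<Sum>N=1..M. t ^ N * S t N / t ^ K) \<longlongrightarrow> (\<Sum>N=1..M. if N \<le> K then l N else 0)) (at_right 0)"
    using low by (intro tendsto_sum) auto
  have "(\<Sum>N=1..M. if N \<le> K then l N else 0) = (\<Sum>N=1..K. l N)"
    using assms(2) by (intro sum.mono_neutral_cong_right) auto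
  then have "eventually (\<lambda>t. 0 < (\<Sum>N=1..M. t ^ N * S t N / t ^ K)) (at_right 0)"
    using pos by (intro order_tendstoD(1)[OF lim]) simp
  moreover have "eventually (\<lambda>t::real. 0 < t) (at_right 0)" by (rule eventually_at_right_less)
  ultimately show ?thesis
  proof eventually_elim
    case (elim t)
    have "0 < (\<Sum>N=1..M. t ^ N * S t N)"
      using elim unfolding sum_divide_distrib[symmetric] by (simp add: zero_less_divide_iff)
    moreover have "(\<Sum>N\<le>M. t ^ N * S t N) = S t 0 + (\<Sum>N=1..M. t ^ N * S t N)"
      by (simp add: sum.atLeast_Suc_atMost atMost_atLeast0)
    ultimately show ?case by simp
  qed
qed

text \<open>Powers are shifted one at a time from the right argument to the left. Each shift flips
  the sign and costs nothing while \<open>g i = 0\<close>. In the middle, symmetry makes both terms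
  of the identity equal, whence the factor 1/2.\<close>

lemma energy_middle:
  fixes G :: "nat \<Rightarrow> nat \<Rightarrow> real"
  assumes "\<And>j k. G (Suc j) k + G j (Suc k) = - g j * g k" and "\<And>j k. G j k = G k j"
    and "\<And>j. j < m \<Longrightarrow> g j = 0"
  shows "G 0 (2 * m + 1) = - ((-1) ^ m * (g m)\<^sup>2 / 2)"
proof -
  have "i \<le> m \<Longrightarrow> G 0 (2 * m + 1) = (-1) ^ i * G i (2 * m + 1 - i)" for i
  proof (induction i)
    case (Suc i)
    have "Suc (2 * m + 1 - Suc i) = 2 * m + 1 - i" using Suc.prems by simp
    then have "G i (2 * m + 1 - i) = - G (Suc i) (2 * m + 1 - Suc i)"
      using assms(1)[of i "2 * m + 1 - Suc i"] assms(3)[of i] Suc.prems by simp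
    then show ?case using Suc by simp
  qed simp
  from this[of m] have "G 0 (2 * m + 1) = (-1) ^ m * G m (Suc m)" by (simp add: mult_2)
  moreover have "G m (Suc m) = - ((g m)\<^sup>2 / 2)"
    using assms(1)[of m m] assms(2)[of m "Suc m"] by (simp add: power2_eq_square)
  ultimately show ?thesis by simp
qed

text \<open>The first term is the loss of the Legendre polynomial, the second the deviation at order
  2 m + 1. As (2 m)! is the central binomial coefficient times (m!)^2, the common factor (m!)^2 / (2
  m + 1) can be taken out, and the hypothesis remains.\<close>

lemma legendre_growth_rate_pos:
  fixes \<gamma> :: real
  assumes "1 + (-1) ^ m * (\<gamma> - 1) * real (2 * m choose m) < 0"
  shows "0 < - ((fact m)\<^sup>2 / real (2 * m + 1)) + 2 * (\<gamma> - 1) * - ((-1) ^ m * (fact (2 * m))\<^sup>2 / 2) / fact (2 * m + 1)"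
proof -
  have b: "fact (2 * m) = real (2 * m choose m) * (fact m)\<^sup>2"
    using binomial_fact[of m "2 * m", where ?'a = real] by (simp add: power2_eq_square)
  have F: "(fact (2 * m + 1) :: real) = real (2 * m + 1) * fact (2 * m)" by simp
  have "2 * (\<gamma> - 1) * - ((-1) ^ m * (fact (2 * m))\<^sup>2 / 2) / fact (2 * m + 1)
      = - ((-1) ^ m * (\<gamma> - 1) * fact (2 * m) / real (2 * m + 1))"
  proof -
    have "2 * (\<gamma> - 1) * - (e * x\<^sup>2 / 2) / (d * x) = - (e * (\<gamma> - 1) * x / d)"
      if "x \<noteq> 0" "d \<noteq> 0" for e x d :: real
      using that by (simp add: power2_eq_square field_simps)
    from this[of "fact (2 * m)" "real (2 * m + 1)" "(-1) ^ m"] show ?thesis unfolding F by simp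
  qed
  also have "- ((fact m)\<^sup>2 / real (2 * m + 1)) + \<dots>
      = - ((fact m)\<^sup>2 / real (2 * m + 1)) * (1 + (-1) ^ m * (\<gamma> - 1) * real (2 * m choose m))"
    unfolding b by (simp add: algebra_simps add_divide_distrib diff_divide_distrib)
  also have "0 < \<dots>" using assms by (intro mult_neg_neg) simp_all
  finally show ?thesis .
qed

text \<open>The scaling of \<open>g\<close> makes all terms of order up to \<open>2m + 1\<close> contribute at the
  same order \<open>t\<^bsup>2m+1\<^esup>\<close>; together they form the integral of the squared Legendre polynomial.\<close>

lemma legendre_energy_growth:
  fixes G :: "real \<Rightarrow> nat \<Rightarrow> nat \<Rightarrow> real" and g :: "real \<Rightarrow> nat \<Rightarrow> real"
  assumes id: "\<And>t j k. G t (Suc j) k + G t j (Suc k) = - g t j * g t k"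
    and sym: "\<And>t j k. G t j k = G t k j"
    and limG: "\<And>j k. ((\<lambda>t. G t j k) \<longlongrightarrow> G 0 j k) (at_right 0)"
    and limg: "\<And>j. ((\<lambda>t. g t j) \<longlongrightarrow> g 0 j) (at_right 0)"
    and g: "\<And>t j. j \<le> m \<Longrightarrow> g t j = fact j * coeff (legendre_poly m) j * t ^ (m - j)"
    and neg: "1 + (-1) ^ m * (c (2 * m + 1) - 1) * real (2 * m choose m) < 0"
    and M: "2 * m + 1 \<le> M"
  shows "eventually (\<lambda>t. energy_coeff (2 * m) c (G t) 0 < (\<Sum>N\<le>M. t ^ N * energy_coeff (2 * m) c (G t) N)) (at_right 0)"
proof -
  let ?K = "2 * m + 1" and ?b = "coeff (legendre_poly m)"
  \<comment> \<open>Rescaled Taylor coefficients of the observed coordinate: t^j g_j / j! equals t^m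
    \<beta>_j. Beyond index \<open>m\<close> they tend to 0, so that only the Legendre polynomial
    survives.\<close>
  define \<beta> where "\<beta> = (\<lambda>t j. if j \<le> m then ?b j else t ^ (j - m) * g t j / fact j)"
  define T where "T = (\<lambda>t N. \<Sum>i\<le>N. \<beta> t i * \<beta> t (N - i))"
  define B where "B = (\<lambda>N. \<Sum>i\<le>N. ?b i * ?b (N - i))"
  \<comment> \<open>The deviation from the exponential series, which within the orders up to
    \<open>?K\<close> occurs at \<open>?K\<close> only.\<close>
  define e where "e = (\<lambda>t N. if N = ?K then 2 * (c ?K - 1) * G t 0 ?K / fact ?K else 0)"
  have g\<beta>: "t ^ j * g t j = t ^ m * fact j * \<beta> t j" for t j
  proof (cases "j \<le> m")
    case True
    then have "t ^ j * t ^ (m - j) = t ^ m" by (simp flip: power_add)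
    then show ?thesis using True by (simp add: g \<beta>_def mult_ac)
  next
    case False
    then have "t ^ m * t ^ (j - m) = t ^ j" by (simp flip: power_add)
    then show ?thesis using False by (simp add: \<beta>_def mult_ac)
  qed
  have "((\<lambda>t. \<beta> t j) \<longlongrightarrow> ?b j) (at_right 0)" for j
  proof (cases "j \<le> m")
    case False
    have "((\<lambda>t. t ^ (j - m) * g t j / fact j) \<longlongrightarrow> 0 ^ (j - m) * g 0 j / fact j) (at_right 0)"
      by (intro tendsto_intros limg) auto
    then show ?thesis using False by (simp add: \<beta>_def coeff_eq_0 degree_legendre_poly power_0_left)
  qed (simp add: \<beta>_def)
  then have limT: "((\<lambda>t. T t N) \<longlongrightarrow> B N) (at_right 0)" for N
    unfolding T_def B_def by (intro tendsto_intros)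
  have lime: "((\<lambda>t. e t N) \<longlongrightarrow> e 0 N) (at_right 0)" for N
    unfolding e_def by (cases "N = ?K") (auto intro!: tendsto_intros limG)
  have S: "t ^ Suc N * energy_coeff (2 * m) c (G t) (Suc N) / t ^ ?K = - T t N / real (Suc N) + e t (Suc N)"
    if "0 < t" "N \<le> 2 * m" for t N
  proof -
    have tN: "t ^ Suc N * (\<Sum>i\<le>N. g t i * g t (N - i) / (fact i * fact (N - i))) = t ^ ?K * T t N"
      unfolding T_def sum_distrib_left
    proof (intro sum.cong refl)
      fix i assume "i \<in> {..N}"
      then have pow: "t ^ Suc N = t * (t ^ i * t ^ (N - i))" by (simp flip: power_add)
      have "t ^ Suc N * (g t i * g t (N - i) / (fact i * fact (N - i)))
          = t * (t ^ i * g t i) * (t ^ (N - i) * g t (N - i)) / (fact i * fact (N - i))"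
        unfolding pow by (simp add: mult_ac)
      also have "\<dots> = (t * t ^ m * t ^ m) * (\<beta> t i * \<beta> t (N - i))"
        unfolding g\<beta> by simp
      also have "t * t ^ m * t ^ m = t ^ ?K" by (simp add: mult_2 power_add)
      finally show "t ^ Suc N * (g t i * g t (N - i) / (fact i * fact (N - i)))
          = t ^ ?K * (\<beta> t i * \<beta> t (N - i))" .
    qed
    have "energy_coeff (2 * m) c (G t) (Suc N)
        = - (\<Sum>i\<le>N. g t i * g t (N - i) / (fact i * fact (N - i))) / real (Suc N) + e t (Suc N)"
    proof (cases "N = 2 * m")
      case True
      then show ?thesis using energy_coeff_Suc_order[of "G t" "g t" "2 * m" c, OF id sym]
        by (simp add: e_def)
    next
      case False
      then show ?thesis using energy_coeff_le_order[of "G t" "g t" N "2 * m" c, OF id] that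
        by (simp add: e_def)
    qed
    then have "t ^ Suc N * energy_coeff (2 * m) c (G t) (Suc N)
        = - (t ^ Suc N * (\<Sum>i\<le>N. g t i * g t (N - i) / (fact i * fact (N - i)))) / real (Suc N)
          + t ^ Suc N * e t (Suc N)"
      by (simp only: distrib_left times_divide_eq_right mult_minus_right)
    \<comment> \<open>Either \<open>Suc N = ?K\<close> or \<open>e t (Suc N) = 0\<close>.\<close>
    also have "t ^ Suc N * e t (Suc N) = t ^ ?K * e t (Suc N)" by (simp add: e_def)
    finally show ?thesis unfolding tN using that by (simp add: add_divide_distrib diff_divide_distrib)
  qed
  let ?l = "\<lambda>N. - B (N - 1) / real N + e 0 N"
  show ?thesis
  proof (rule eventually_energy_gt[where l = ?l and K = ?K and h = "energy_coeff (2 * m) c (G 0)"])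
    fix N assume N: "0 < N" "N \<le> ?K"
    then obtain N' where N': "N = Suc N'" "N' \<le> 2 * m" by (cases N) auto
    have "((\<lambda>t. - T t N' / real N + e t N) \<longlongrightarrow> - B N' / real N + e 0 N) (at_right 0)"
      using N by (intro tendsto_intros limT lime) auto
    moreover have "eventually (\<lambda>t. - T t N' / real N + e t N = t ^ N * energy_coeff (2 * m) c (G t) N / t ^ ?K) (at_right 0)"
      using eventually_at_right_less[of "0::real"] by eventually_elim (simp only: N' S)
    ultimately show "((\<lambda>t. t ^ N * energy_coeff (2 * m) c (G t) N / t ^ ?K) \<longlongrightarrow> ?l N) (at_right 0)"
      using N' by (auto intro: Lim_transform_eventually)
  next
    show "((\<lambda>t. energy_coeff (2 * m) c (G t) N) \<longlongrightarrow> energy_coeff (2 * m) c (G 0) N) (at_right 0)" for N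
      unfolding energy_coeff_def by (intro tendsto_intros limG)
  next
    have "(\<Sum>N=1..?K. ?l N) = (\<Sum>N\<le>2*m. - B N / real (Suc N) + e 0 (Suc N))"
      unfolding atMost_atLeast0 using sum.shift_bounds_cl_Suc_ivl[of ?l 0 "2 * m"] by simp
    also have "\<dots> = - unit_integral (legendre_poly m ^ 2) + (\<Sum>N\<le>2*m. e 0 (Suc N))"
      unfolding unit_integral_square[OF degree_legendre_poly] B_def
      by (simp add: sum_subtractf)
    also have "(\<Sum>N\<le>2*m. e 0 (Suc N)) = 2 * (c ?K - 1) * G 0 0 ?K / fact ?K"
      by (simp add: e_def)
    \<comment> \<open>At t = 0 the prescribed values \<open>g 0 j\<close> with j < m contain a
      positive power of 0, as \<open>energy_middle\<close> demands.\<close>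
    also have "G 0 0 ?K = - ((-1) ^ m * (g 0 m)\<^sup>2 / 2)"
      by (rule energy_middle[of "G 0" "g 0" m, OF id sym]) (simp add: g)
    also have "g 0 m = fact (2 * m)" by (simp add: g coeff_legendre_poly)
    finally show "0 < (\<Sum>N=1..?K. ?l N)"
      using legendre_growth_rate_pos[OF neg] by (simp only: unit_integral_legendre_square)
  qed (use M in auto)
qed

section \<open>Krylov Gram numbers and strong stability\<close>

text \<open>Complex polynomials with the same values have the same coefficients; for indices beyond
  \<open>s\<close> both sides are 0.\<close>

lemma poly_sum_eq_rk_coeff:
  fixes R :: "complex poly"
  assumes "p \<le> s"
    and "\<And>z. poly R z = (\<Sum>j=0..p. z ^ j / fact j)
                  + (\<Sum>j=p+1..s. complex_of_real (c j) * (z ^ j / fact j))"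
    and "\<And>j. j \<ge> s + 1 \<Longrightarrow> c j = 0"
  shows "coeff R k = complex_of_real (rk_coeff p c k)"
proof -
  have "R = (\<Sum>j\<le>s. monom (complex_of_real (rk_coeff p c j)) j)"
  proof (rule poly_ext)
    fix z
    have "poly (\<Sum>j\<le>s. monom (complex_of_real (rk_coeff p c j)) j) z
        = (\<Sum>j\<in>{0..p} \<union> {p+1..s}. complex_of_real (rk_coeff p c j) * z ^ j)"
      using assms(1) by (auto simp: poly_sum poly_monom intro!: sum.cong)
    also have "\<dots> = (\<Sum>j=0..p. complex_of_real (rk_coeff p c j) * z ^ j)
        + (\<Sum>j=p+1..s. complex_of_real (rk_coeff p c j) * z ^ j)"
      by (rule sum.union_disjoint) auto
    also have "\<dots> = poly R z"
      unfolding assms(2) by (intro arg_cong2[where f = "(+)"] sum.cong) (auto simp: rk_coeff_def)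
    finally show "poly R z = poly (\<Sum>j\<le>s. monom (complex_of_real (rk_coeff p c j)) j) z" by simp
  qed
  then have "coeff R k = (\<Sum>j\<le>s. if j = k then complex_of_real (rk_coeff p c j) else 0)"
    by (simp only: coeff_sum coeff_monom)
  also have "\<dots> = complex_of_real (rk_coeff p c k)"
    using assms(1,3) by (auto simp: rk_coeff_def)
  finally show ?thesis .
qed

section \<open>Matrix polynomials acting on Krylov vectors\<close>

lemma funpow_mult_vec_carrier:
  assumes "A \<in> carrier_mat n n" "u \<in> carrier_vec n"
  shows "((*\<^sub>v) A ^^ k) u \<in> carrier_vec n"
  using assms by (induction k) auto

lemma pow_mat_mult_vec:
  fixes A :: "'a :: comm_semiring_1 mat"
  assumes "A \<in> carrier_mat n n" "u \<in> carrier_vec n"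
  shows "(A ^\<^sub>m k) *\<^sub>v u = ((*\<^sub>v) A ^^ k) u"
  using assms(2)
proof (induction k arbitrary: u)
  case 0
  then show ?case using assms(1) by simp
next
  case (Suc k)
  then have "(A ^\<^sub>m Suc k) *\<^sub>v u = (A ^\<^sub>m k) *\<^sub>v (A *\<^sub>v u)"
    using assms(1) by (simp add: assoc_mult_mat_vec[of _ n n _ n])
  then show ?case using Suc assms(1) by (simp add: funpow_swap1)
qed

lemma funpow_smult_mat_mult_vec:
  fixes A :: "'a :: comm_semiring_1 mat"
  assumes "A \<in> carrier_mat n n" "u \<in> carrier_vec n"
  shows "((*\<^sub>v) (x \<cdot>\<^sub>m A) ^^ k) u = x ^ k \<cdot>\<^sub>v ((*\<^sub>v) A ^^ k) u"
proof (induction k)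
  case (Suc k)
  have "(x \<cdot>\<^sub>m A) *\<^sub>v (x ^ k \<cdot>\<^sub>v ((*\<^sub>v) A ^^ k) u) = x ^ Suc k \<cdot>\<^sub>v (A *\<^sub>v ((*\<^sub>v) A ^^ k) u)"
    using assms(1) funpow_mult_vec_carrier[OF assms, of k]
    by (intro eq_vecI) (auto simp: mult_ac)
  then show ?case using Suc by simp
qed (use assms in auto)

lemma poly_mat_carrier:
  "A \<in> carrier_mat n n \<Longrightarrow> poly_mat R A \<in> carrier_mat n n"
  by (simp add: poly_mat_def)

lemma poly_mat_smult_mult_vec:
  assumes "A \<in> carrier_mat n n" "u \<in> carrier_vec n" "i < n" "degree R \<le> d"
  shows "(poly_mat R (x \<cdot>\<^sub>m A) *\<^sub>v u) $ i = (\<Sum>k\<le>d. coeff R k * x ^ k * (((*\<^sub>v) A ^^ k) u) $ i)"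
proof -
  have "(poly_mat R (x \<cdot>\<^sub>m A) *\<^sub>v u) $ i
      = (\<Sum>l<n. (\<Sum>k\<le>degree R. coeff R k * ((x \<cdot>\<^sub>m A) ^\<^sub>m k) $$ (i, l)) * u $ l)"
    using assms by (simp add: poly_mat_def scalar_prod_def atLeast0LessThan)
  also have "\<dots> = (\<Sum>k\<le>degree R. coeff R k * (\<Sum>l<n. ((x \<cdot>\<^sub>m A) ^\<^sub>m k) $$ (i, l) * u $ l))"
    unfolding sum_distrib_left sum_distrib_right by (subst sum.swap) (simp add: mult_ac)
  also have "\<dots> = (\<Sum>k\<le>degree R. coeff R k * (((x \<cdot>\<^sub>m A) ^\<^sub>m k) *\<^sub>v u) $ i)"
    using assms by (intro sum.cong refl) (simp add: scalar_prod_def atLeast0LessThan)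
  also have "\<dots> = (\<Sum>k\<le>degree R. coeff R k * x ^ k * (((*\<^sub>v) A ^^ k) u) $ i)"
  proof (intro sum.cong refl)
    fix k
    have "((x \<cdot>\<^sub>m A) ^\<^sub>m k) *\<^sub>v u = x ^ k \<cdot>\<^sub>v ((*\<^sub>v) A ^^ k) u"
      using assms pow_mat_mult_vec[of "x \<cdot>\<^sub>m A" n u k] funpow_smult_mat_mult_vec[OF assms(1,2), where x = x and k = k] by simp
    then show "coeff R k * (((x \<cdot>\<^sub>m A) ^\<^sub>m k) *\<^sub>v u) $ i = coeff R k * x ^ k * (((*\<^sub>v) A ^^ k) u) $ i"
      using assms(3) funpow_mult_vec_carrier[OF assms(1,2), of k] by simp
  qed
  also have "\<dots> = (\<Sum>k\<le>d. coeff R k * x ^ k * (((*\<^sub>v) A ^^ k) u) $ i)"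
    using assms(4) by (intro sum.mono_neutral_left) (auto simp: coeff_eq_0)
  finally show ?thesis .
qed

text \<open>Real parts suffice: the coefficients of \<open>R\<close> and the time step are real, so
  the squared norm depends on nothing else.\<close>

definition krylov_gram :: "complex mat \<Rightarrow> complex vec \<Rightarrow> nat \<Rightarrow> nat \<Rightarrow> real" where
  "krylov_gram L u j k = Re (((*\<^sub>v) L ^^ j) u \<bullet>c ((*\<^sub>v) L ^^ k) u)"

lemma Re_cscalar_prod:
  fixes v w :: "complex vec"
  assumes "w \<in> carrier_vec n"
  shows "Re (v \<bullet>c w) = (\<Sum>i<n. Re (v $ i * cnj (w $ i)))"
  unfolding scalar_prod_def Re_sum using assms
  by (intro sum.cong) (auto simp: conjugate_complex_def)

lemma krylov_gram_altdef:
  assumes "L \<in> carrier_mat n n" "u \<in> carrier_vec n"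
  shows "krylov_gram L u j k = (\<Sum>i<n. Re ((((*\<^sub>v) L ^^ j) u) $ i * cnj ((((*\<^sub>v) L ^^ k) u) $ i)))"
  unfolding krylov_gram_def by (rule Re_cscalar_prod[OF funpow_mult_vec_carrier[OF assms]])

lemma norm_P_one:
  assumes "u \<in> carrier_vec n"
  shows "norm_P (1\<^sub>m n) u = sqrt (Re (u \<bullet>c u))"
  using assms by (simp add: norm_P_def)

text \<open>Expand the product coordinatewise as a double sum over powers of \<open>L\<close>, then
  collect equal powers of \<open>t\<close> along the diagonals.\<close>

lemma poly_mat_energy:
  fixes t :: real
  assumes L: "L \<in> carrier_mat n n" and u: "u \<in> carrier_vec n"
    and r: "\<And>k. coeff R k = complex_of_real (rk_coeff p c k)" "\<And>k. s < k \<Longrightarrow> rk_coeff p c k = 0"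
  defines "w \<equiv> poly_mat R (complex_of_real t \<cdot>\<^sub>m L) *\<^sub>v u"
  shows "Re (w \<bullet>c w) = (\<Sum>N\<le>2*s. t ^ N * energy_coeff p c (krylov_gram L u) N)"
proof -
  let ?x = "\<lambda>k i. (((*\<^sub>v) L ^^ k) u) $ i" and ?r = "rk_coeff p c"
  have d: "degree R \<le> s" using r by (intro degree_le) simp
  have w: "w \<in> carrier_vec n"
    unfolding w_def by (rule mult_mat_vec_carrier[OF poly_mat_carrier[OF smult_carrier_mat[OF L]] u])
  have wi: "w $ i = (\<Sum>k\<le>s. complex_of_real (?r k * t ^ k) * ?x k i)" if "i < n" for i
    unfolding w_def poly_mat_smult_mult_vec[OF L u that d] r by simp
  have "Re (w \<bullet>c w) = (\<Sum>i<n. Re (w $ i * cnj (w $ i)))"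
    by (rule Re_cscalar_prod[OF w])
  also have "\<dots> = (\<Sum>i<n. \<Sum>j\<le>s. \<Sum>k\<le>s. ?r j * ?r k * t ^ (j + k) * Re (?x j i * cnj (?x k i)))"
  proof (intro sum.cong refl)
    fix i assume "i \<in> {..<n}"
    then have "w $ i * cnj (w $ i)
        = (\<Sum>j\<le>s. \<Sum>k\<le>s. complex_of_real (?r j * ?r k * t ^ (j + k)) * (?x j i * cnj (?x k i)))"
      by (simp add: wi sum_product power_add mult_ac)
    then show "Re (w $ i * cnj (w $ i)) = (\<Sum>j\<le>s. \<Sum>k\<le>s. ?r j * ?r k * t ^ (j + k) * Re (?x j i * cnj (?x k i)))"
      by (simp only: Re_sum Re_complex_of_real Im_complex_of_real times_complex.simps) simp
  qed
  also have "\<dots> = (\<Sum>j\<le>s. \<Sum>k\<le>s. ?r j * ?r k * t ^ (j + k) * krylov_gram L u j k)"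
    unfolding krylov_gram_altdef[OF L u] sum_distrib_left
    by (rule trans[OF sum.swap sum.cong[OF refl sum.swap]])
  also have "\<dots> = (\<Sum>N\<le>2*s. \<Sum>i\<le>N. ?r i * ?r (N - i) * t ^ (i + (N - i)) * krylov_gram L u i (N - i))"
    by (rule sum_square_eq_sum_diagonals) (auto simp: r(2))
  also have "\<dots> = (\<Sum>N\<le>2*s. t ^ N * energy_coeff p c (krylov_gram L u) N)"
    unfolding energy_coeff_def sum_distrib_left by (intro sum.cong refl) simp
  finally show ?thesis .
qed

lemma mat_adjoint_carrier: "A \<in> carrier_mat m n \<Longrightarrow> mat_adjoint A \<in> carrier_mat n m"
  by (intro carrier_matI) (simp_all add: mat_adjoint_def)

lemma mat_adjoint_index:
  assumes "i < dim_col A" "j < dim_row A"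
  shows "mat_adjoint A $$ (i, j) = conjugate (A $$ (j, i))"
  using assms by (simp add: mat_adjoint_def mat_of_rows_index)

lemma pos_def_hermitian_one: "pos_def_hermitian n (1\<^sub>m n)"
proof -
  have "mat_adjoint (1\<^sub>m n) \<in> carrier_mat n n" by (simp add: mat_adjoint_carrier)
  then have "mat_adjoint (1\<^sub>m n) = (1\<^sub>m n :: complex mat)"
    by (intro eq_matI) (auto simp: mat_adjoint_index)
  then show ?thesis
    unfolding pos_def_hermitian_def hermitian_mat_def
    by (intro conjI ballI impI) (simp_all only: one_carrier_mat one_mult_mat_vec conjugate_square_greater_0_vec not_False_eq_True)
qed

text \<open>Strong stability is tested with \<open>P = 1\<close>, the Euclidean norm. Growth for all
  small \<open>t\<close> includes some \<open>t\<close> below the threshold, and there the initial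
  value \<open>u t\<close> contradicts stability.\<close>

lemma not_strongly_stableI:
  assumes stab: "is_stability_function s a b R"
    and r: "\<And>k. coeff R k = complex_of_real (rk_coeff p c k)" "\<And>k. s < k \<Longrightarrow> rk_coeff p c k = 0"
    and n: "1 \<le> n" and L: "L \<in> carrier_mat n n" and lyap: "lyapunov_stable L"
    and diss: "neg_semidef_hermitian n (mat_adjoint L + L)"
    and u: "\<And>t. u t \<in> carrier_vec n"
    and growth: "eventually (\<lambda>t. krylov_gram L (u t) 0 0
        < (\<Sum>N\<le>2*s. t ^ N * energy_coeff p c (krylov_gram L (u t)) N)) (at_right 0)"
  shows "\<not> strongly_stable s a b"
proof
  assume "strongly_stable s a b"
  moreover have "mat_adjoint L * 1\<^sub>m n + 1\<^sub>m n * L = mat_adjoint L + L"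
    using L by (simp add: right_mult_one_mat[of _ n] mat_adjoint_carrier)
  ultimately obtain t\<^sub>0 where t\<^sub>0: "0 < t\<^sub>0"
    "\<And>t v. 0 < t \<Longrightarrow> t \<le> t\<^sub>0 \<Longrightarrow> v \<in> carrier_vec n \<Longrightarrow> norm_P (1\<^sub>m n) (rk_step s a b L t v) \<le> norm_P (1\<^sub>m n) v"
    using n L lyap diss pos_def_hermitian_one[of n] unfolding strongly_stable_def by metis
  have "eventually (\<lambda>t. 0 < t \<and> t \<le> t\<^sub>0) (at_right 0)"
    using t\<^sub>0(1) unfolding eventually_at_right_field by (intro exI[of _ t\<^sub>0]) auto
  from eventually_happens[OF eventually_conj[OF growth this]]
  obtain t where t: "0 < t" "t \<le> t\<^sub>0"
    and gt: "krylov_gram L (u t) 0 0 < (\<Sum>N\<le>2*s. t ^ N * energy_coeff p c (krylov_gram L (u t)) N)"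
    by (auto simp: trivial_limit_at_right_real)
  let ?w = "poly_mat R (complex_of_real t \<cdot>\<^sub>m L) *\<^sub>v u t"
  have w: "?w \<in> carrier_vec n" 
    by (rule mult_mat_vec_carrier[OF poly_mat_carrier[OF smult_carrier_mat[OF L]] u])
  have eq: "rk_step s a b L t (u t) = ?w"
    using stab n L t u unfolding is_stability_function_def by blast
  have "Re (?w \<bullet>c ?w) \<le> Re (u t \<bullet>c u t)"
    using t\<^sub>0(2)[OF t u[of t]] unfolding eq norm_P_one[OF w] norm_P_one[OF u]
    by (simp only: real_sqrt_le_iff)
  then show False using gt poly_mat_energy[OF L u[of t] r, where t = t] by (simp add: krylov_gram_def)
qed

section \<open>The counterexamples\<close>

text \<open>A skew-symmetric tridiagonal matrix minus half the projection onto the first coordinate. All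
  dissipation happens there, and it takes \<open>m\<close> applications of the matrix until the first
  coordinate sees coordinate \<open>m\<close>.\<close>

definition chain_entry :: "nat \<Rightarrow> nat \<Rightarrow> real" where
  "chain_entry i k = (if k = Suc i then 1 else if i = Suc k then -1 else if i = 0 \<and> k = 0 then -1/2 else 0)"

definition chain_op :: "nat \<Rightarrow> (nat \<Rightarrow> real) \<Rightarrow> nat \<Rightarrow> real" where
  "chain_op n f i = (\<Sum>k<n. chain_entry i k * f k)"

definition chain_inner :: "nat \<Rightarrow> (nat \<Rightarrow> real) \<Rightarrow> (nat \<Rightarrow> real) \<Rightarrow> real" where
  "chain_inner n f h = (\<Sum>i<n. f i * h i)"

lemma chain_inner_commute: "chain_inner n f h = chain_inner n h f"
  by (simp add: chain_inner_def mult.commute)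

lemma chain_entry_add_transpose: "chain_entry i k + chain_entry k i = (if i = 0 \<and> k = 0 then -1 else 0)"
  by (auto simp: chain_entry_def)

text \<open>The skew part cancels; the corner entry -1/2 is counted twice.\<close>

lemma chain_inner_chain_op:
  assumes "0 < n"
  shows "chain_inner n (chain_op n f) h + chain_inner n f (chain_op n h) = - f 0 * h 0"
proof -
  have "chain_inner n (chain_op n f) h + chain_inner n f (chain_op n h)
      = (\<Sum>i<n. \<Sum>k<n. chain_entry i k * (f k * h i)) + (\<Sum>k<n. \<Sum>i<n. chain_entry k i * (f k * h i))"
    by (simp add: chain_inner_def chain_op_def sum_distrib_left sum_distrib_right mult_ac)
  also have "\<dots> = (\<Sum>i<n. \<Sum>k<n. (chain_entry i k + chain_entry k i) * (f k * h i))"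
    by (subst (2) sum.swap) (simp add: sum.distrib distrib_right)
  also have "\<dots> = (\<Sum>i<n. \<Sum>k<n. if i = 0 \<and> k = 0 then - f 0 * h 0 else 0)"
    by (intro sum.cong refl) (simp add: chain_entry_add_transpose)
  also have "\<dots> = (\<Sum>i<n. if i = 0 then - f 0 * h 0 else 0)"
    using assms by (intro sum.cong refl) (simp add: if_distrib cong: if_cong)
  also have "\<dots> = - f 0 * h 0" using assms by simp
  finally show ?thesis .
qed

lemma chain_op_linear:
  "chain_op n (\<lambda>i. \<Sum>l\<in>A. w l * F l i) = (\<lambda>i. \<Sum>l\<in>A. w l * chain_op n (F l) i)"
  by (rule ext, simp add: chain_op_def sum_distrib_left, subst sum.swap, simp add: mult_ac)

lemma chain_op_pow_linear:
  "(chain_op n ^^ j) (\<lambda>i. \<Sum>l\<in>A. w l * F l i) = (\<lambda>i. \<Sum>l\<in>A. w l * (chain_op n ^^ j) (F l) i)"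
  by (induction j) (simp_all add: chain_op_linear)

text \<open>A unit pulse travels towards coordinate 0 by at most one place per application, and its
  front keeps height 1 because the superdiagonal entries are 1.\<close>

lemma chain_op_pow_unit:
  assumes "k < n" "i + j \<le> k"
  shows "(chain_op n ^^ j) (\<lambda>l. if l = k then 1 else 0) i = (if i + j = k then 1 else 0)"
  using assms(2)
proof (induction j arbitrary: i)
  case (Suc j)
  let ?y = "(chain_op n ^^ j) (\<lambda>l. if l = k then 1 else 0)"
  have "chain_op n ?y i = (\<Sum>l<n. chain_entry i l * ?y l)"
    by (rule chain_op_def)
  also have "\<dots> = (\<Sum>l\<in>{Suc i}. chain_entry i l * ?y l)"
  proof (intro sum.mono_neutral_right ballI)
    \<comment> \<open>For l \<le> i the front has not yet reached \<open>l\<close>; for l > i + 1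
      the matrix entry is 0.\<close>
    show "chain_entry i l * ?y l = 0" if "l \<in> {..<n} - {Suc i}" for l
    proof (cases "l \<le> i")
      case True
      then show ?thesis using Suc.IH[of l] Suc.prems by simp
    qed (use that in \<open>simp add: chain_entry_def\<close>)
  qed (use Suc.prems assms(1) in auto)
  also have "\<dots> = (if i + Suc j = k then 1 else 0)"
    using Suc by (simp add: chain_entry_def)
  finally show ?case by simp
qed auto

text \<open>The observation map is triangular: the unit vector at \<open>k\<close> is invisible at
  coordinate 0 for fewer than \<open>k\<close> applications and shows with weight 1 after exactly
  \<open>k\<close>. It therefore corrects the last value alone.\<close>

lemma chain_observable:
  assumes "k \<le> n"
  shows "\<exists>f. \<forall>j<k. (chain_op n ^^ j) f 0 = a j"
  using assms
proof (induction k)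
  case (Suc k)
  then obtain f where f: "\<And>j. j < k \<Longrightarrow> (chain_op n ^^ j) f 0 = a j" by auto
  let ?e = "\<lambda>l. if l = k then 1 else 0 :: real"
  define d where "d = a k - (chain_op n ^^ k) f 0"
  \<comment> \<open>The combination of \<open>f\<close> and \<open>d\<close> times the unit vector
    is written as a sum over the booleans, the form that \<open>chain_op_pow_linear\<close>
    handles.\<close>
  define F where "F = (\<lambda>b. if b then f else ?e)"
  define w where "w = (\<lambda>b. if b then 1 else d)"
  have "(chain_op n ^^ j) (\<lambda>i. \<Sum>b\<in>UNIV. w b * F b i) 0 = a j" if "j < Suc k" for j
    unfolding chain_op_pow_linear using that f[of j] chain_op_pow_unit[of k n 0 j] Suc.prems
    by (auto simp: UNIV_bool F_def w_def d_def less_Suc_eq)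
  then show ?case by blast
qed simp

section \<open>Growth without dissipation\<close>

lemma energy_coeff_0: "energy_coeff p c G 0 = G 0 0"
  by (simp add: energy_coeff_def rk_coeff_def)

text \<open>For an initial value independent of \<open>t\<close>, the first nonzero coefficient of
  positive order decides.\<close>

lemma constant_energy_growth:
  assumes "0 < K" "K \<le> M" and "\<And>N. 0 < N \<Longrightarrow> N < K \<Longrightarrow> E N = 0" and "0 < E K"
  shows "eventually (\<lambda>t::real. E 0 < (\<Sum>N\<le>M. t ^ N * E N)) (at_right 0)"
proof (rule eventually_energy_gt[where S = "\<lambda>_. E" and K = K and h = E and l = "\<lambda>N. if N = K then E K else 0"])
  show "((\<lambda>t. t ^ N * E N / t ^ K) \<longlongrightarrow> (if N = K then E K else 0)) (at_right 0)"
    if "0 < N" "N \<le> K" for N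
  proof (cases "N = K")
    case True
    have "eventually (\<lambda>t::real. E K = t ^ N * E N / t ^ K) (at_right 0)"
      using eventually_at_right_less[of "0::real"] by eventually_elim (simp add: True)
    then show ?thesis using True by (auto intro: Lim_transform_eventually[OF tendsto_const])
  next
    case False
    then show ?thesis using assms(3)[of N] that by simp
  qed
  show "0 < (\<Sum>N=1..K. if N = K then E K else 0)" using assms(1,4) by simp
qed (use assms in auto)

text \<open>The Gram numbers of the scalar system L = i with u = 1.\<close>

definition rotation_gram :: "nat \<Rightarrow> nat \<Rightarrow> real" where
  "rotation_gram j k = Re (\<i> ^ j * cnj (\<i> ^ k))"

lemma rotation_gram_Suc: "rotation_gram (Suc j) k + rotation_gram j (Suc k) = 0"
  by (simp add: rotation_gram_def)

lemma rotation_gram_commute: "rotation_gram j k = rotation_gram k j"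
proof -
  have "cnj (\<i> ^ j * cnj (\<i> ^ k)) = \<i> ^ k * cnj (\<i> ^ j)"
    by (simp only: complex_cnj_mult complex_cnj_cnj mult.commute)
  then show ?thesis unfolding rotation_gram_def by (metis cnj.simps(1))
qed

lemma rotation_gram_0_even: "rotation_gram 0 (2 * q) = (-1) ^ q"
proof -
  have "cnj (\<i> ^ (2 * q)) = complex_of_real ((-1) ^ q)" by (simp add: power_mult)
  then show ?thesis by (simp only: rotation_gram_def power_0 mult_1 Re_complex_of_real)
qed

lemma rotation_gram_0_odd: "rotation_gram 0 (Suc (2 * q)) = 0"
proof -
  have "cnj (\<i> ^ Suc (2 * q)) = - \<i> * complex_of_real ((-1) ^ q)" by (simp add: power_mult)
  then show ?thesis by (simp only: rotation_gram_def power_0 mult_1) simp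
qed

lemma rotation_energy_le_order:
  assumes "0 < N" "N \<le> p"
  shows "energy_coeff p c rotation_gram N = 0"
  using energy_coeff_le_order[of rotation_gram "\<lambda>_. 0" "N - 1" p c] assms rotation_gram_Suc by simp

text \<open>Since p + 1 is even, i^(p + 1) is real, and the first deviation appears at order p + 1
  with the sign (-1)^((p + 1) / 2).\<close>

lemma rotation_growth_odd:
  assumes "odd p" "(-1) ^ ((p + 1) div 2) * (1 - c (p + 1)) < (0 :: real)" "p + 1 \<le> M"
  shows "eventually (\<lambda>t. rotation_gram 0 0 < (\<Sum>N\<le>M. t ^ N * energy_coeff p c rotation_gram N)) (at_right 0)"
proof -
  obtain q where q: "Suc p = 2 * q" using assms(1) by (metis even_Suc evenE)
  have "energy_coeff p c rotation_gram (Suc p) = 2 * ((c (Suc p) - 1) * (-1) ^ q) / fact (Suc p)"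
    using energy_coeff_Suc_order[of rotation_gram "\<lambda>_. 0" p c] rotation_gram_Suc rotation_gram_commute
      rotation_gram_0_even[of q] q by (simp del: fact_Suc)
  moreover have "0 < (c (Suc p) - 1) * (-1) ^ q" using assms(2) q by (simp add: algebra_simps)
  ultimately have "0 < energy_coeff p c rotation_gram (Suc p)" by (simp del: fact_Suc)
  then show ?thesis
    using constant_energy_growth[of "Suc p" M "energy_coeff p c rotation_gram"] assms(3)
      rotation_energy_le_order[of _ p c] by (simp add: energy_coeff_0)
qed

text \<open>Since p + 1 is odd, i^(p + 1) is imaginary and the order p + 1 drops out; the order p +
  2 decides.\<close>

lemma rotation_growth_even:
  assumes "even p" "1 \<le> p" "p + 2 \<le> M"
    "(-1) ^ (p div 2) * (c (p + 2) - (real p + 2) * c (p + 1) + (real p + 1)) < 0"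
  shows "eventually (\<lambda>t. rotation_gram 0 0 < (\<Sum>N\<le>M. t ^ N * energy_coeff p c rotation_gram N)) (at_right 0)"
proof -
  obtain q where q: "p = 2 * q" using assms(1) by (elim evenE)
  have "rotation_gram 0 (p + 2) = - ((-1) ^ (p div 2))"
    using rotation_gram_0_even[of "Suc q"] q by simp
  then have "energy_coeff p c rotation_gram (Suc (Suc p))
      = - (2 * ((-1) ^ (p div 2) * (c (p + 2) - (real p + 2) * c (p + 1) + (real p + 1)))) / fact (p + 2)"
    using energy_coeff_Suc_Suc_order[of rotation_gram p c, OF rotation_gram_Suc rotation_gram_commute assms(2)]
    by (simp add: mult_ac)
  also have "0 < \<dots>" using assms(4) by (simp del: fact_Suc add: divide_neg_pos)
  finally have pos: "0 < energy_coeff p c rotation_gram (Suc (Suc p))" .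
  have "energy_coeff p c rotation_gram (Suc p) = 0"
    using energy_coeff_Suc_order[of rotation_gram "\<lambda>_. 0" p c] rotation_gram_Suc rotation_gram_commute
      rotation_gram_0_odd[of q] q by simp
  then have "energy_coeff p c rotation_gram N = 0" if "0 < N" "N < Suc (Suc p)" for N
    using that rotation_energy_le_order[of N p c] by (cases "N = Suc p") auto
  then show ?thesis
    using constant_energy_growth[of "Suc (Suc p)" M "energy_coeff p c rotation_gram"] assms(3) pos
    by (simp add: energy_coeff_0)
qed

section \<open>The chain as a complex matrix\<close>

definition chain_mat :: "nat \<Rightarrow> complex mat" where
  "chain_mat n = mat n n (\<lambda>(i, k). complex_of_real (chain_entry i k))"

definition chain_vec :: "nat \<Rightarrow> (nat \<Rightarrow> real) \<Rightarrow> complex vec" where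
  "chain_vec n f = vec n (\<lambda>i. complex_of_real (f i))"

lemma chain_mat_carrier: "chain_mat n \<in> carrier_mat n n"
  by (simp add: chain_mat_def)

lemma chain_vec_carrier: "chain_vec n f \<in> carrier_vec n"
  by (simp add: chain_vec_def)

text \<open>The matrix is real, so it acts on real and imaginary parts separately.\<close>

lemma chain_mat_mult_index:
  assumes "v \<in> carrier_vec n" "i < n"
  shows "(chain_mat n *\<^sub>v v) $ i
    = complex_of_real (chain_op n (\<lambda>k. Re (v $ k)) i) + \<i> * complex_of_real (chain_op n (\<lambda>k. Im (v $ k)) i)"
proof -
  have "(chain_mat n *\<^sub>v v) $ i = (\<Sum>k<n. complex_of_real (chain_entry i k) * v $ k)"
    using assms by (simp add: chain_mat_def scalar_prod_def atLeast0LessThan)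
  also have "\<dots> = (\<Sum>k<n. complex_of_real (chain_entry i k * Re (v $ k)) + \<i> * complex_of_real (chain_entry i k * Im (v $ k)))"
    by (intro sum.cong refl) (simp add: complex_eq_iff)
  finally show ?thesis by (simp only: chain_op_def of_real_sum sum_distrib_left sum.distrib)
qed

lemma chain_mat_mult_chain_vec: "chain_mat n *\<^sub>v chain_vec n f = chain_vec n (chain_op n f)"
proof (rule eq_vecI)
  fix i assume "i < dim_vec (chain_vec n (chain_op n f))"
  then have i: "i < n" by (simp add: chain_vec_def)
  have "chain_op n (\<lambda>k. Re (chain_vec n f $ k)) i = chain_op n f i"
    "chain_op n (\<lambda>k. Im (chain_vec n f $ k)) i = 0"
    by (simp_all add: chain_op_def chain_vec_def)
  then show "(chain_mat n *\<^sub>v chain_vec n f) $ i = chain_vec n (chain_op n f) $ i"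
    using chain_mat_mult_index[OF chain_vec_carrier i] i by (simp add: chain_vec_def)
qed (simp add: chain_mat_def chain_vec_def)

lemma funpow_chain_mat_chain_vec:
  "((*\<^sub>v) (chain_mat n) ^^ k) (chain_vec n f) = chain_vec n ((chain_op n ^^ k) f)"
  by (induction k) (simp_all add: chain_mat_mult_chain_vec)

lemma krylov_gram_chain:
  "krylov_gram (chain_mat n) (chain_vec n f) j k = chain_inner n ((chain_op n ^^ j) f) ((chain_op n ^^ k) f)"
  unfolding krylov_gram_altdef[OF chain_mat_carrier chain_vec_carrier] funpow_chain_mat_chain_vec chain_inner_def
  by (intro sum.cong refl) (simp add: chain_vec_def)

text \<open>Here \<open>f\<close> and \<open>h\<close> are the real and imaginary parts of an
  eigenvector v for x + i y. The energy identity gives 2 x |v|^2 = - |v_0|^2, so x \<le> 0. If x =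
  0, then v_0 = 0, and the eigenvalue equation forces the remaining coordinates to vanish one after
  another.\<close>

lemma chain_eigenvalue_neg:
  assumes n: "0 < n" and nz: "\<exists>i<n. f i \<noteq> 0 \<or> h i \<noteq> 0"
    and f: "\<And>i. i < n \<Longrightarrow> chain_op n f i = x * f i - y * h i"
    and h: "\<And>i. i < n \<Longrightarrow> chain_op n h i = x * h i + y * f i"
  shows "x < 0"
proof -
  let ?q = "\<Sum>i<n. (f i)\<^sup>2 + (h i)\<^sup>2"
  obtain i where i: "i < n" "f i \<noteq> 0 \<or> h i \<noteq> 0" using nz by blast
  then have pos: "0 < ?q"
    by (intro sum_pos2[of _ i]) (auto simp: sum_power2_gt_zero_iff)
  have "x * ?q = chain_inner n (chain_op n f) f + chain_inner n (chain_op n h) h"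
    unfolding chain_inner_def sum.distrib[symmetric] sum_distrib_left
    by (intro sum.cong refl) (simp add: f h power2_eq_square algebra_simps)
  also have "2 * \<dots> = - ((f 0)\<^sup>2 + (h 0)\<^sup>2)"
    using chain_inner_chain_op[OF n, of f f] chain_inner_chain_op[OF n, of h h]
    by (simp add: chain_inner_commute[of n f] chain_inner_commute[of n h] power2_eq_square)
  finally have x: "2 * (x * ?q) = - ((f 0)\<^sup>2 + (h 0)\<^sup>2)" by simp
  have "x \<noteq> 0"
  proof
    assume x0: "x = 0"
    have zero: "f k = 0 \<and> h k = 0" if "k < n" for k
      using that
    proof (induction k rule: less_induct)
      case (less k)
      show ?case
      proof (cases k)
        case 0
        have "(f 0)\<^sup>2 + (h 0)\<^sup>2 = 0" using x unfolding x0 by linarith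
        then show ?thesis using 0 by (simp add: sum_power2_eq_zero_iff)
      next
        case (Suc l)
        \<comment> \<open>Row \<open>l\<close> reaches no further than coordinate l + 1 = k, where
          its entry is 1; the earlier coordinates are already 0.\<close>
        have step: "chain_op n F l = F k" if "\<And>i. i < k \<Longrightarrow> F i = 0" for F
        proof -
          have "chain_op n F l = (\<Sum>j\<in>{k}. chain_entry l j * F j)"
            unfolding chain_op_def using less.prems that Suc
            by (intro sum.mono_neutral_right) (auto simp: chain_entry_def)
          then show ?thesis using Suc by (simp add: chain_entry_def)
        qed
        have IH: "\<And>i. i < k \<Longrightarrow> f i = 0" "\<And>i. i < k \<Longrightarrow> h i = 0" using less by auto
        then show ?thesis
          using step[of f] step[of h] f[of l] h[of l] x0 less.prems Suc by simp
      qed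
    qed
    then show False using i by blast
  qed
  moreover have "x \<le> 0"
  proof (rule ccontr)
    assume "\<not> x \<le> 0"
    then have "0 < x * ?q" using pos by simp
    then show False using x sum_power2_ge_zero[of "f 0" "h 0"] by linarith
  qed
  ultimately show ?thesis by simp
qed

lemma lyapunov_stable_chain_mat:
  assumes "0 < n"
  shows "lyapunov_stable (chain_mat n)"
proof -
  have "Re \<mu> < 0" if "eigenvalue (chain_mat n) \<mu>" for \<mu>
  proof -
    from that obtain v where v: "v \<in> carrier_vec n" "v \<noteq> 0\<^sub>v n" "chain_mat n *\<^sub>v v = \<mu> \<cdot>\<^sub>v v"
      by (auto simp: eigenvalue_def eigenvector_def chain_mat_def)
    have eq: "complex_of_real (chain_op n (\<lambda>k. Re (v $ k)) i) + \<i> * complex_of_real (chain_op n (\<lambda>k. Im (v $ k)) i)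
        = \<mu> * v $ i" if "i < n" for i
      using chain_mat_mult_index[OF v(1) that] v that by simp
    have "\<exists>i<n. v $ i \<noteq> 0" using v(1,2) by (metis carrier_vecD eq_vecI index_zero_vec)
    then have "\<exists>i<n. Re (v $ i) \<noteq> 0 \<or> Im (v $ i) \<noteq> 0" by (simp add: complex_eq_iff)
    then show ?thesis
    proof (rule chain_eigenvalue_neg[OF assms])
      fix i assume "i < n"
      from arg_cong[OF eq[OF this], of Re] arg_cong[OF eq[OF this], of Im]
      show "chain_op n (\<lambda>k. Re (v $ k)) i = Re \<mu> * Re (v $ i) - Im \<mu> * Im (v $ i)"
        "chain_op n (\<lambda>k. Im (v $ k)) i = Re \<mu> * Im (v $ i) + Im \<mu> * Re (v $ i)"
        by simp_all
    qed
  qed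
  then show ?thesis unfolding lyapunov_stable_def by (metis less_eq_real_def less_irrefl)
qed

lemma funpow_rotation:
  "((*\<^sub>v) (jordan_block 1 \<i>) ^^ k) (vec 1 (\<lambda>_. 1)) = vec 1 (\<lambda>_. \<i> ^ k)"
  by (induction k) (auto intro!: eq_vecI simp: scalar_prod_def)

lemma krylov_gram_rotation:
  "krylov_gram (jordan_block 1 \<i>) (vec 1 (\<lambda>_. 1)) = rotation_gram"
proof (intro ext)
  fix j k
  show "krylov_gram (jordan_block 1 \<i>) (vec 1 (\<lambda>_. 1)) j k = rotation_gram j k"
    using krylov_gram_altdef[of "jordan_block 1 \<i>" 1 "vec 1 (\<lambda>_. 1)" j k]
    unfolding funpow_rotation by (simp add: rotation_gram_def)
qed

text \<open>The eigenvalue i lies on the imaginary axis, so both multiplicities have to be computed.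
  Writing the scalar as a Jordan block of size 1 gives access to its characteristic polynomial and
  eigenspace dimension; both multiplicities are 1.\<close>

lemma lyapunov_stable_rotation: "lyapunov_stable (jordan_block 1 \<i>)"
proof -
  have "jordan_matrix [(1, \<i>)] = jordan_block 1 \<i>"
    by (simp only: jordan_matrix_def list.map prod.case diag_block_mat_singleton)
  then have "kernel_dim (char_matrix (jordan_block 1 \<i>) \<i> ^\<^sub>m 1) = 1"
    using dim_gen_eigenspace_jordan_matrix[of "[(1, \<i>)]" \<i> 1] unfolding dim_gen_eigenspace_def by simp
  then have "kernel_dim (char_matrix (jordan_block 1 \<i>) \<i>) = 1"
    by simp
  moreover have "Polynomial.order \<i> (char_poly (jordan_block 1 \<i>)) = 1"
    using order_power_n_n[of \<i> 1] by (simp only: jordan_block_char_poly)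
  ultimately have "nondefective (jordan_block 1 \<i>) \<i>" by (simp only: nondefective_def)
  moreover have "\<mu> = \<i>" if "eigenvalue (jordan_block 1 \<i>) \<mu>" for \<mu>
    using that unfolding eigenvalue_root_char_poly[OF jordan_block_carrier] jordan_block_char_poly by simp
  ultimately show ?thesis unfolding lyapunov_stable_def by (metis imaginary_unit.simps(1) order_refl)
qed

lemma hermitian_matI:
  assumes A: "A \<in> carrier_mat n n" and "\<And>i j. i < n \<Longrightarrow> j < n \<Longrightarrow> cnj (A $$ (j, i)) = A $$ (i, j)"
  shows "hermitian_mat A"
  unfolding hermitian_mat_def
proof (rule eq_matI)
  fix i j assume "i < dim_row A" "j < dim_col A"
  then show "mat_adjoint A $$ (i, j) = A $$ (i, j)"
    using assms by (simp add: mat_adjoint_index)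
qed (use A mat_adjoint_carrier[OF A] in auto)

lemma neg_semidef_rotation:
  "neg_semidef_hermitian 1 (mat_adjoint (jordan_block 1 \<i>) + jordan_block 1 \<i>)"
proof -
  have "mat_adjoint (jordan_block 1 \<i>) \<in> carrier_mat 1 1"
    by (intro mat_adjoint_carrier jordan_block_carrier)
  then have zero: "mat_adjoint (jordan_block 1 \<i>) + jordan_block 1 \<i> = 0\<^sub>m 1 1"
    by (intro eq_matI) (simp_all add: mat_adjoint_index)
  have "hermitian_mat (0\<^sub>m 1 1)" by (rule hermitian_matI[of _ 1]) simp_all
  moreover have "(0\<^sub>m 1 1 *\<^sub>v v) \<bullet>c v \<le> 0" if "v \<in> carrier_vec 1" for v :: "complex vec"
    using that by (simp add: scalar_prod_def)
  ultimately show ?thesis unfolding zero neg_semidef_hermitian_def by simp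
qed

text \<open>The sum is minus the projection onto the first coordinate, so the quadratic form is -
  |v_0|^2.\<close>

lemma neg_semidef_chain_mat:
  assumes "0 < n"
  shows "neg_semidef_hermitian n (mat_adjoint (chain_mat n) + chain_mat n)"
proof -
  define D :: "complex mat" where "D = mat n n (\<lambda>(i, k). if i = 0 \<and> k = 0 then -1 else 0)"
  have Dc: "D \<in> carrier_mat n n" by (simp add: D_def)
  have D: "mat_adjoint (chain_mat n) + chain_mat n = D"
  proof (rule eq_matI)
    fix i k assume "i < dim_row D" "k < dim_col D"
    then have ik: "i < n" "k < n" by (simp_all add: D_def)
    then have "(mat_adjoint (chain_mat n) + chain_mat n) $$ (i, k)
        = complex_of_real (chain_entry k i + chain_entry i k)"
      by (simp add: mat_adjoint_index chain_mat_def)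
    then show "(mat_adjoint (chain_mat n) + chain_mat n) $$ (i, k) = D $$ (i, k)"
      using ik by (auto simp: chain_entry_add_transpose D_def)
  qed (use mat_adjoint_carrier[OF chain_mat_carrier[of n]] chain_mat_carrier[of n] Dc in auto)
  have "hermitian_mat D" by (rule hermitian_matI[OF Dc]) (auto simp: D_def)
  moreover have "(D *\<^sub>v v) \<bullet>c v \<le> 0" if v: "v \<in> carrier_vec n" for v
  proof -
    have Dv: "(D *\<^sub>v v) $ i = (if i = 0 then - v $ 0 else 0)" if "i < n" for i
    proof -
      have "(D *\<^sub>v v) $ i = (\<Sum>k<n. (if i = 0 \<and> k = 0 then -1 else 0) * v $ k)"
        using v that by (simp add: D_def scalar_prod_def atLeast0LessThan)
      also have "\<dots> = (\<Sum>k<n. if k = 0 then (if i = 0 then - v $ 0 else 0) else 0)"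
        by (intro sum.cong refl) simp
      finally show ?thesis using assms by simp
    qed
    have "(D *\<^sub>v v) \<bullet>c v = (\<Sum>i<n. (D *\<^sub>v v) $ i * cnj (v $ i))"
      unfolding scalar_prod_def using v by (intro sum.cong) auto
    also have "\<dots> = (\<Sum>i<n. if i = 0 then - (v $ 0 * cnj (v $ 0)) else 0)"
      by (intro sum.cong refl) (simp add: Dv)
    also have "\<dots> = - complex_of_real ((cmod (v $ 0))\<^sup>2)"
      using assms by (simp add: complex_norm_square del: of_real_power)
    also have "\<dots> \<le> 0" by (simp add: less_eq_complex_def)
    finally show ?thesis .
  qed
  ultimately show ?thesis unfolding D neg_semidef_hermitian_def using Dc by simp
qed

text \<open>The initial value may depend on the time step, since strong stability asks for one threshold
  for all initial values.\<close>

lemma chain_growth: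
  assumes neg: "1 + (-1) ^ m * (c (2 * m + 1) - 1) * real (2 * m choose m) < 0" and M: "2 * m + 1 \<le> M"
  obtains f where "eventually (\<lambda>t. krylov_gram (chain_mat (Suc m)) (chain_vec (Suc m) (f t)) 0 0
    < (\<Sum>N\<le>M. t ^ N * energy_coeff (2 * m) c (krylov_gram (chain_mat (Suc m)) (chain_vec (Suc m) (f t))) N)) (at_right 0)"
proof -
  let ?T = "chain_op (Suc m)"
  \<comment> \<open>Dimension m + 1 allows m + 1 observed values to be prescribed. The dual basis
    \<open>F\<close> is fixed once; all dependence on \<open>t\<close> goes into the weights
    \<open>w\<close>, polynomial in \<open>t\<close>, so that the limits at 0 exist.\<close>
  have "\<forall>l. \<exists>F. \<forall>j<Suc m. (?T ^^ j) F 0 = (if j = l then 1 else 0)"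
    by (intro allI chain_observable) simp
  then have "\<exists>F. \<forall>l. \<forall>j<Suc m. (?T ^^ j) (F l) 0 = (if j = l then 1 else 0)" by (rule choice)
  then obtain F where "\<forall>l. \<forall>j<Suc m. (?T ^^ j) (F l) 0 = (if j = l then 1 else 0)" ..
  then have F: "(?T ^^ j) (F l) 0 = (if j = l then 1 else 0)" if "j \<le> m" for l j
    using that by (simp add: less_Suc_eq_le)
  define w where "w = (\<lambda>t l. fact l * coeff (legendre_poly m) l * t ^ (m - l))"
  define f where "f = (\<lambda>t i. \<Sum>l\<le>m. w t l * F l i)"
  define X where "X = (\<lambda>t j i. \<Sum>l\<le>m. w t l * (?T ^^ j) (F l) i)"
  have X: "(?T ^^ j) (f t) = X t j" for t j
    unfolding f_def X_def by (rule chain_op_pow_linear)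
  then have X_Suc: "?T (X t j) = X t (Suc j)" for t j
    unfolding X[symmetric] by simp
  have limX: "((\<lambda>t. X t j i) \<longlongrightarrow> X 0 j i) (at_right 0)" for j i
    unfolding X_def w_def by (intro tendsto_intros)
  let ?G = "\<lambda>t j k. chain_inner (Suc m) (X t j) (X t k)"
  have "eventually (\<lambda>t. energy_coeff (2 * m) c (?G t) 0
      < (\<Sum>N\<le>M. t ^ N * energy_coeff (2 * m) c (?G t) N)) (at_right 0)"
  proof (rule legendre_energy_growth[where G = ?G and g = "\<lambda>t j. X t j 0"])
    show "?G t (Suc j) k + ?G t j (Suc k) = - X t j 0 * X t k 0" for t j k
      using chain_inner_chain_op[of "Suc m" "X t j" "X t k"] by (simp add: X_Suc)
    show "?G t j k = ?G t k j" for t j k by (rule chain_inner_commute)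
    show "((\<lambda>t. ?G t j k) \<longlongrightarrow> ?G 0 j k) (at_right 0)" for j k
      unfolding chain_inner_def by (intro tendsto_intros limX)
    show "((\<lambda>t. X t j 0) \<longlongrightarrow> X 0 j 0) (at_right 0)" for j by (rule limX)
    show "X t j 0 = fact j * coeff (legendre_poly m) j * t ^ (m - j)" if "j \<le> m" for t j
    proof -
      have "X t j 0 = (\<Sum>l\<le>m. if j = l then w t l else 0)"
        unfolding X_def F[OF that] by (intro sum.cong refl) simp
      then show ?thesis using that by (simp add: w_def)
    qed
  qed (fact neg M)+
  moreover have "krylov_gram (chain_mat (Suc m)) (chain_vec (Suc m) (f t)) = ?G t" for t
    by (intro ext) (simp only: krylov_gram_chain X)
  ultimately show ?thesis by (intro that[of f]) (simp only: energy_coeff_0)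
qed

theorem theorem3:
  fixes p s :: nat
    and a :: "nat \<Rightarrow> nat \<Rightarrow> real" and b :: "nat \<Rightarrow> real"
    and c :: "nat \<Rightarrow> real" and R :: "complex poly"
  assumes "p \<ge> 1" and "s \<ge> p"
    and "is_stability_function s a b R"
    and "\<And>z. poly R z = (\<Sum>j=0..p. z ^ j / fact j)
                  + (\<Sum>j=p+1..s. complex_of_real (c j) * (z ^ j / fact j))"
    and "c (p + 1) \<noteq> 1"
    and "\<And>j. j \<ge> s + 1 \<Longrightarrow> c j = 0"
    and "(odd p \<and> (-1) ^ ((p + 1) div 2) * (1 - c (p + 1)) < 0)
       \<or> (even p \<and>
           ((-1) ^ (p div 2) * (c (p + 2) - (real p + 2) * c (p + 1) + (real p + 1)) < 0
            \<or> 1 + (-1) ^ (p div 2) * (c (p + 1) - 1) * real (p choose (p div 2)) < 0))"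
  shows "\<not> strongly_stable s a b"
proof -
  have r: "coeff R k = complex_of_real (rk_coeff p c k)" for k
    using assms(2,4,6) by (rule poly_sum_eq_rk_coeff)
  have r0: "rk_coeff p c k = 0" if "s < k" for k
    using that assms(2) assms(6)[of k] by (simp add: rk_coeff_def)
  note criterion = not_strongly_stableI[OF assms(3) r r0]
  have rotation: "\<not> strongly_stable s a b"
    if "eventually (\<lambda>t. rotation_gram 0 0
      < (\<Sum>N\<le>2*s. t ^ N * energy_coeff p c rotation_gram N)) (at_right 0)"
    by (rule criterion[where n = 1 and L = "jordan_block 1 \<i>" and u = "\<lambda>_. vec 1 (\<lambda>_. 1)"])
      (use that lyapunov_stable_rotation neg_semidef_rotation in \<open>simp_all only: krylov_gram_rotation jordan_block_carrier order_refl vec_carrier\<close>)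
  consider "odd p" "(-1) ^ ((p + 1) div 2) * (1 - c (p + 1)) < 0"
    | "even p" "(-1) ^ (p div 2) * (c (p + 2) - (real p + 2) * c (p + 1) + (real p + 1)) < 0"
    | "even p" "1 + (-1) ^ (p div 2) * (c (p + 1) - 1) * real (p choose (p div 2)) < 0"
    using assms(7) by blast
  then show ?thesis
  proof cases
    case 1
    then show ?thesis using assms(1,2) by (intro rotation rotation_growth_odd) auto
  next
    case 2
    \<comment> \<open>An even p \<ge> 1 is at least 2, so even for s = p the expansion up to order 2
      s contains the order p + 2.\<close>
    then have "p + 2 \<le> 2 * s" using assms(1,2) by (elim evenE) simp
    then show ?thesis using 2 assms(1) by (intro rotation rotation_growth_even) auto
  next
    case 3
    then obtain m where m: "p = 2 * m" by (elim evenE)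
    have "2 * m + 1 \<le> 2 * s" using assms(1,2) m by simp
    moreover have "1 + (-1) ^ m * (c (2 * m + 1) - 1) * real (2 * m choose m) < 0"
      using 3(2) by (simp add: m)
    ultimately obtain f where f: "eventually (\<lambda>t. krylov_gram (chain_mat (Suc m)) (chain_vec (Suc m) (f t)) 0 0
      < (\<Sum>N\<le>2*s. t ^ N * energy_coeff (2 * m) c (krylov_gram (chain_mat (Suc m)) (chain_vec (Suc m) (f t))) N)) (at_right 0)"
      using chain_growth by blast
    show ?thesis
      by (rule criterion[OF _ _ chain_mat_carrier lyapunov_stable_chain_mat neg_semidef_chain_mat chain_vec_carrier f[folded m]])
        simp_all
  qed
qed

end
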